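(* Let $\{\mathcal V_{W\dot W},\mathcal V_{P\dot P}\}$ be $\mathcal E$-linked through $\mathcal V^1_{WP},\mathcal V^2_{\dot W\dot P}$. 1. Let $\mathcal V_P$ be invariant in $\mathcal V_{P\dot P}$ with $(\mathcal V_P)_{\dot P}\subseteq\mathcal V_{P\dot P}\circ\dot P$, let $(\mathcal V^1_{WP}\times W)_{\dot W}=\mathcal V^2_{\dot W\dot P}\times\dot W$, and let $\mathcal V_W:=(\mathcal V^2_{\dot W\dot P})_{WP}\leftrightarrow\mathcal V_P$. Then (a) $\mathcal V_W=\mathcal V^1_{WP}\leftrightarrow\mathcal V_P$, and $\mathcal V_W$ is invariant in $\mathcal V_{W\dot W}$ with $\mathcal V_{W\dot W}\circ\dot W\supseteq(\mathcal V_W)_{\dot W}$; (b) $\{\mathcal V_{W\dot W}+(\mathcal V_W\oplus(\mathcal V_W)_{\dot W}),\ \mathcal V_{P\dot P}+(\mathcal V_P\oplus(\mathcal V_P)_{\dot P})\}$ is also $\mathcal E$-linked through $\mathcal V^1_{WP},\mathcal V^2_{\dot W\dot P}$. 2. Let $\mathcal V_P$ be invariant in $\mathcal V_{P\dot P}$ with $\mathcal V_P\supseteq\mathcal V_{P\dot P}\times P$, let $(\mathcal V^1_{WP}\circ W)_{\dot W}=\mathcal V^2_{\dot W\dot P}\circ\dot W$, and let $\mathcal V_W:=\mathcal V^1_{WP}\leftrightarrow\mathcal V_P$. Then (a) $(\mathcal V_W)_{\dot W}=\mathcal V^2_{\dot W\dot P}\leftrightarrow(\mathcal V_P)_{\dot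 P}$, and $\mathcal V_W$ is invariant in $\mathcal V_{W\dot W}$ with $\mathcal V_{W\dot W}\times W\subseteq\mathcal V_W$; (b) $\{\mathcal V_{W\dot W}\cap(\mathcal V_W\oplus(\mathcal V_W)_{\dot W}),\ \mathcal V_{P\dot P}\cap(\mathcal V_P\oplus(\mathcal V_P)_{\dot P})\}$ is also $\mathcal E$-linked through $\mathcal V^1_{WP},\mathcal V^2_{\dot W\dot P}$.
   Context: Fix a field $\mathbb F$; all index sets are finite. A vector on $X$ is a function $X\to\mathbb F$. $W,\dot W$ are disjoint copies of each other (in bijection), $P,\dot P$ likewise, all four pairwise disjoint; subscripts such as $(\mathcal V^2_{\dot W\dot P})_{WP}$, $(\mathcal V_W)_{\dot W}$ denote relabelling of index sets along bijections. $\mathcal V_{W\dot W}$, $\mathcal V_{P\dot P}$, $\mathcal V^1_{WP}$, $\mathcal V^2_{\dot W\dot P}$, $\mathcal V_P$ denote linear subspaces of vectors on the indicated disjoint unions. $\mathcal V_{XY}\circ X:=\{f_X:(f_X,g_Y)\in\mathcal V_{XY}\text{ for some }g_Y\}$, $\mathcal V_{XY}\times X:=\{f_X:(f_X,0_Y)\in\mathcal V_{XY}\}$. For spaces on sets $X,Y$, $\mathcal V_X\leftrightarrow\mathcal V_Y$ is the space on $(X\setminus Y)\uplus(Y\setminus X)$ of all $(g_{X\setminus Y},h_{Y\setminus X})$ with $g\in\mathcal V_X$, $h\in\mathcal V_Y$ and $g,h$ equal on $X\cap Y$. $\{\mathcal V_{W\dot W},\mathcal V_{P\dot P}\}$ is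 $\mathcal E$-linked through $\mathcal V^1_{WP},\mathcal V^2_{\dot W\dot P}$ if $\mathcal V^1_{WP}\supseteq(\mathcal V^2_{\dot W\dot P})_{WP}$, $\mathcal V_{W\dot W}=\mathcal V_{P\dot P}\leftrightarrow(\mathcal V^1_{WP}\oplus\mathcal V^2_{\dot W\dot P})$ and $\mathcal V_{P\dot P}=\mathcal V_{W\dot W}\leftrightarrow(\mathcal V^1_{WP}\oplus\mathcal V^2_{\dot W\dot P})$. $\mathcal V_W$ is invariant in $\mathcal V_{W\dot W}$ iff $\mathcal V_{W\dot W}\leftrightarrow\mathcal V_W\subseteq(\mathcal V_W)_{\dot W}$ and $\mathcal V_{W\dot W}\leftrightarrow(\mathcal V_W)_{\dot W}\supseteq\mathcal V_W$. (Same for $P,\dot P$.) *)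

theory Defs
  imports Complex_Main "HOL-Library.Function_Algebras" "HOL-Library.Set_Algebras"
begin

text \<open>
  All index sets are subsets of one ambient type. A vector on \<open>X\<close> is represented by its extension
  by zero to the whole type. Hence, for disjoint \<open>X\<close> and \<open>Y\<close>, the vector \<open>(f, g)\<close> on \<open>X \<union> Y\<close> with
  parts \<open>f\<close> on \<open>X\<close> and \<open>g\<close> on \<open>Y\<close> is the pointwise sum \<open>f + g\<close>, and \<open>(f, 0)\<close> is \<open>f\<close> itself.
\<close>

interpretation fun_vs: vector_space "\<lambda>(c :: 'f :: field) (f :: 'a \<Rightarrow> 'f) i. c * f i"
  by standard (auto simp: fun_eq_iff algebra_simps)

definition vecs :: "'a set \<Rightarrow> ('a \<Rightarrow> 'f :: field) set" where
  "vecs X = {f. \<forall>i. i \<notin> X \<longrightarrow> f i = 0}"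

definition restr :: "'a set \<Rightarrow> ('a \<Rightarrow> 'f :: field) \<Rightarrow> ('a \<Rightarrow> 'f)" where
  "restr X f = (\<lambda>i. if i \<in> X then f i else 0)"

definition vspace :: "'a set \<Rightarrow> ('a \<Rightarrow> 'f :: field) set \<Rightarrow> bool" where
  "vspace X V \<longleftrightarrow> V \<subseteq> vecs X \<and> fun_vs.subspace V"

text \<open>Relabelling of a space on \<open>X\<close> along \<open>\<sigma>\<close>, which is meant to be injective on \<open>X\<close>.\<close>

definition relabel :: "('a \<Rightarrow> 'a) \<Rightarrow> 'a set \<Rightarrow> ('a \<Rightarrow> 'f :: field) set \<Rightarrow> ('a \<Rightarrow> 'f) set" where
  "relabel \<sigma> X V = {g \<in> vecs (\<sigma> ` X). \<exists>f\<in>V. \<forall>x\<in>X. g (\<sigma> x) = f x}"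

text \<open>\<open>vrestrict V X\<close> is $\mathcal V \circ X$ and \<open>vcontract V X\<close> is $\mathcal V \times X$.\<close>

definition vrestrict :: "('a \<Rightarrow> 'f :: field) set \<Rightarrow> 'a set \<Rightarrow> ('a \<Rightarrow> 'f) set" where
  "vrestrict V X = {restr X h | h. h \<in> V}"

definition vcontract :: "('a \<Rightarrow> 'f :: field) set \<Rightarrow> 'a set \<Rightarrow> ('a \<Rightarrow> 'f) set" where
  "vcontract V X = {f \<in> vecs X. f \<in> V}"

text \<open>\<open>V \<oplus> U\<close> for spaces on disjoint index sets.\<close>

definition direct_sum :: "('a \<Rightarrow> 'f :: field) set \<Rightarrow> ('a \<Rightarrow> 'f) set \<Rightarrow> ('a \<Rightarrow> 'f) set"
    (infixl "\<oplus>" 65) where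
  "V \<oplus> U = {f + g | f g. f \<in> V \<and> g \<in> U}"

text \<open>\<open>matched X V Y U\<close> is $\mathcal V \leftrightarrow \mathcal U$ for \<open>V\<close> on \<open>X\<close> and \<open>U\<close> on \<open>Y\<close>.\<close>

definition matched ::
    "'a set \<Rightarrow> ('a \<Rightarrow> 'f :: field) set \<Rightarrow> 'a set \<Rightarrow> ('a \<Rightarrow> 'f) set \<Rightarrow> ('a \<Rightarrow> 'f) set" where
  "matched X V Y U =
     {restr (X - Y) g + restr (Y - X) h | g h. g \<in> V \<and> h \<in> U \<and> (\<forall>i \<in> X \<inter> Y. g i = h i)}"

text \<open>
  In the following two definitions \<open>dot\<close> restricts to the bijections from \<open>W\<close> to its copy \<open>W'\<close> and
  from \<open>P\<close> to its copy \<open>P'\<close>, respectively from \<open>X\<close> to \<open>X'\<close>. That the arguments are vector spaces on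
  the appropriate index sets is part of the definitions.
\<close>

definition E_linked ::
    "('a \<Rightarrow> 'a) \<Rightarrow> 'a set \<Rightarrow> 'a set \<Rightarrow> 'a set \<Rightarrow> 'a set \<Rightarrow>
     ('a \<Rightarrow> 'f :: field) set \<Rightarrow> ('a \<Rightarrow> 'f) set \<Rightarrow> ('a \<Rightarrow> 'f) set \<Rightarrow> ('a \<Rightarrow> 'f) set \<Rightarrow> bool" where
  "E_linked dot W W' P P' VWW' VPP' V1 V2 \<longleftrightarrow>
     vspace (W \<union> W') VWW' \<and> vspace (P \<union> P') VPP' \<and> vspace (W \<union> P) V1 \<and> vspace (W' \<union> P') V2 \<and>
     V1 \<supseteq> relabel (inv_into (W \<union> P) dot) (W' \<union> P') V2 \<and>
     VWW' = matched (P \<union> P') VPP' ((W \<union> P) \<union> (W' \<union> P')) (V1 \<oplus> V2) \<and>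
     VPP' = matched (W \<union> W') VWW' ((W \<union> P) \<union> (W' \<union> P')) (V1 \<oplus> V2)"

definition invariant_in ::
    "('a \<Rightarrow> 'a) \<Rightarrow> 'a set \<Rightarrow> 'a set \<Rightarrow> ('a \<Rightarrow> 'f :: field) set \<Rightarrow> ('a \<Rightarrow> 'f) set \<Rightarrow> bool" where
  "invariant_in dot X X' VX VXX' \<longleftrightarrow>
     vspace X VX \<and> vspace (X \<union> X') VXX' \<and>
     matched (X \<union> X') VXX' X VX \<subseteq> relabel dot X VX \<and>
     matched (X \<union> X') VXX' X' (relabel dot X VX) \<supseteq> VX"

end

theory Submission
  imports Defs "HOL-Library.Product_Plus"
begin

text \<open>
  Removing the dots turns every space into a linear relation: $\mathcal V_{W\dot W}$ becomes a
  relation \<open>R\<close> between vectors on \<open>W\<close>, $\mathcal V_{P\dot P}$ a relation \<open>S\<close> between vectors on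
  \<open>P\<close>, and $\mathcal V^1_{WP}$, $\mathcal V^2_{\dot W\dot P}$ become relations \<open>A \<supseteq> B\<close> between
  vectors on \<open>W\<close> and vectors on \<open>P\<close>. Matching is composition, so being $\mathcal E$-linked means
  \<open>R = A O S O B\<inverse>\<close> and \<open>S = A\<inverse> O R O B\<close>; invariance of \<open>U\<close> in \<open>S\<close> means \<open>S `` U \<subseteq> U\<close> and
  \<open>U \<subseteq> S\<inverse> `` U\<close>; and the space on \<open>W\<close> belonging to \<open>U\<close> is the pullback \<open>A\<inverse> `` U\<close> or
  \<open>B\<inverse> `` U\<close>. In this form only addition and subtraction matter, so the argument takes place in
  abelian groups.

  The crucial remark is that \<open>(0, p) \<in> A\<close> implies \<open>(p, 0) \<in> S\<close>, because \<open>(0, 0) \<in> R\<close>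
  (\<open>A_fibre_in_S\<close>). Hence two values of \<open>A\<close> at the same element have the same images under \<open>S\<close>
  (\<open>S_A_shift\<close>), and invariance passes from \<open>U\<close> to its pullback as soon as the pullbacks along \<open>A\<close> and
  \<open>B\<close> coincide (\<open>invariant_pullback\<close>). They coincide in both cases of the theorem. If
  \<open>U \<subseteq> Range S\<close> and \<open>A\<close>, \<open>B\<close> have the same fibre over \<open>0\<close>, one corrects a partner under \<open>A\<close> by an
  element of this fibre (\<open>pullbacks_eq_if_Range\<close>). If \<open>U\<close> contains all \<open>p\<close> with \<open>(p, 0) \<in> S\<close> and
  \<open>A\<close>, \<open>B\<close> have the same domain, any value of \<open>B\<close> at an element of the pullback lies in \<open>U\<close>
  (\<open>pullbacks_eq_if_Domain\<close>).

  The new linkages follow in the same spirit. In the first case elements of \<open>U\<close> and of the pullback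
  have partners in each other, which can be subtracted from a linked pair (\<open>linked_sum\<close>). In the
  second case linked elements lie in the pullback and in \<open>U\<close> simultaneously (\<open>linked_Int\<close>).
\<close>

section \<open>Linked relations between abelian groups\<close>

definition add_subgroup :: "'g :: ab_group_add set \<Rightarrow> bool" where
  "add_subgroup G \<longleftrightarrow> 0 \<in> G \<and> (\<forall>x\<in>G. \<forall>y\<in>G. x - y \<in> G)"

lemma add_subgroup_zero: "add_subgroup G \<Longrightarrow> 0 \<in> G"
  by (simp add: add_subgroup_def)

lemma add_subgroup_diff: "add_subgroup G \<Longrightarrow> x \<in> G \<Longrightarrow> y \<in> G \<Longrightarrow> x - y \<in> G"
  by (simp add: add_subgroup_def)

lemma add_subgroup_add: "add_subgroup G \<Longrightarrow> x \<in> G \<Longrightarrow> y \<in> G \<Longrightarrow> x + y \<in> G"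
  using add_subgroup_diff[of G x "0 - y"] add_subgroup_diff[of G 0 y] add_subgroup_zero[of G]
  by simp

lemma rel_zero: "add_subgroup G \<Longrightarrow> (0, 0) \<in> G"
  by (drule add_subgroup_zero) (simp add: zero_prod_def)

lemma rel_diff: "add_subgroup G \<Longrightarrow> (x, y) \<in> G \<Longrightarrow> (u, v) \<in> G \<Longrightarrow> (x - u, y - v) \<in> G"
  using add_subgroup_diff[of G "(x, y)" "(u, v)"] by simp

lemma rel_add: "add_subgroup G \<Longrightarrow> (x, y) \<in> G \<Longrightarrow> (u, v) \<in> G \<Longrightarrow> (x + u, y + v) \<in> G"
  using add_subgroup_add[of G "(x, y)" "(u, v)"] by simp

text \<open>
The conditions of an $\mathcal E$-linkage after all dots are removed: \<open>R\<close> stands for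
$\mathcal V_{W\dot W}$, \<open>S\<close> for $\mathcal V_{P\dot P}$, \<open>A\<close> for $\mathcal V^1_{WP}$ and \<open>B\<close> for
$(\mathcal V^2_{\dot W\dot P})_{WP}$. Matching two spaces is then composition of relations.
\<close>

definition linked :: "('w \<times> 'w) set \<Rightarrow> ('p \<times> 'p) set \<Rightarrow> ('w \<times> 'p) set \<Rightarrow> ('w \<times> 'p) set \<Rightarrow> bool" where
  "linked R S A B \<longleftrightarrow> B \<subseteq> A \<and> R = A O S O B\<inverse> \<and> S = A\<inverse> O R O B"

locale linked_relations =
  fixes R :: "('w :: ab_group_add \<times> 'w) set" and S :: "('p :: ab_group_add \<times> 'p) set"
    and A B :: "('w \<times> 'p) set"
  assumes subR: "add_subgroup R" and subS: "add_subgroup S"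
    and subA: "add_subgroup A" and subB: "add_subgroup B"
    and linked: "linked R S A B"
begin

lemma B_A: "(w, p) \<in> B \<Longrightarrow> (w, p) \<in> A"
  using linked by (auto simp: linked_def)

lemma R_I: "(p, p') \<in> S \<Longrightarrow> (w, p) \<in> A \<Longrightarrow> (w', p') \<in> B \<Longrightarrow> (w, w') \<in> R"
  using linked unfolding linked_def by blast

lemma R_E:
  assumes "(w, w') \<in> R"
  obtains p p' where "(p, p') \<in> S" "(w, p) \<in> A" "(w', p') \<in> B"
proof -
  have "(w, w') \<in> A O S O B\<inverse>" using assms linked unfolding linked_def by blast
  then show ?thesis using that by blast
qed

lemma S_I: "(w, w') \<in> R \<Longrightarrow> (w, p) \<in> A \<Longrightarrow> (w', p') \<in> B \<Longrightarrow> (p, p') \<in> S"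
  using linked unfolding linked_def by blast

lemma S_E:
  assumes "(p, p') \<in> S"
  obtains w w' where "(w, w') \<in> R" "(w, p) \<in> A" "(w', p') \<in> B"
proof -
  have "(p, p') \<in> A\<inverse> O R O B" using assms linked unfolding linked_def by blast
  then show ?thesis using that by blast
qed

text \<open>
Since \<open>(0, 0)\<close> belongs to \<open>R\<close> and \<open>B\<close>, the linkage carries the zero pair of \<open>R\<close> to
\<open>(p, 0)\<close>. This is why the choice among several values of \<open>A\<close> at one element does not matter to \<open>S\<close>.
\<close>

lemma A_fibre_in_S: "(0, p) \<in> A \<Longrightarrow> (p, 0) \<in> S"
  by (rule S_I[OF rel_zero[OF subR] _ rel_zero[OF subB]])

lemma B_fibre_in_S: "(0, p) \<in> B \<Longrightarrow> (0, p) \<in> S"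
  by (rule S_I[OF rel_zero[OF subR] rel_zero[OF subA]])

lemma A_two_values:
  assumes "(w, p) \<in> A" "(w, q) \<in> A"
  shows "(p - q, 0) \<in> S"
  using A_fibre_in_S[of "p - q"] rel_diff[OF subA assms] by simp

lemma S_A_shift:
  assumes "(w, p) \<in> A" "(w, q) \<in> A" "(p, p') \<in> S"
  shows "(q, p') \<in> S"
  using rel_add[OF subS assms(3) A_two_values[OF assms(2,1)]] by simp

text \<open>
Invariance needs only that the pullbacks of \<open>U\<close> along \<open>A\<close> and \<open>B\<close> agree; the extra hypotheses of
the two cases of the theorem serve to establish this agreement. Forward, a pair of \<open>R\<close> starting in
the pullback is witnessed by a pair of \<open>S\<close>, whose left entry may be exchanged for one in \<open>U\<close> by
\<open>S_A_shift\<close>. Backward, a pair of \<open>S\<close> that realizes invariance of \<open>U\<close> is lifted to \<open>R\<close>.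
\<close>

lemma invariant_pullback:
  assumes U: "S `` U \<subseteq> U" "U \<subseteq> S\<inverse> `` U" and AB: "A\<inverse> `` U = B\<inverse> `` U"
  shows "R `` (A\<inverse> `` U) \<subseteq> A\<inverse> `` U" "A\<inverse> `` U \<subseteq> R\<inverse> `` (A\<inverse> `` U)"
proof -
  show "R `` (A\<inverse> `` U) \<subseteq> A\<inverse> `` U"
  proof
    fix w' assume "w' \<in> R `` (A\<inverse> `` U)"
    then obtain w q where wq: "(w, w') \<in> R" "(w, q) \<in> A" "q \<in> U" by blast
    obtain p p' where pp: "(p, p') \<in> S" "(w, p) \<in> A" "(w', p') \<in> B" using wq(1) by (rule R_E)
    \<comment> \<open>\<open>p\<close> itself need not lie in \<open>U\<close>, but \<open>q\<close> does and has the same image \<open>p'\<close>.\<close>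
    have "p' \<in> U" using S_A_shift[OF pp(2) wq(2) pp(1)] wq(3) U(1) by blast
    then show "w' \<in> A\<inverse> `` U" using B_A[OF pp(3)] by blast
  qed
  show "A\<inverse> `` U \<subseteq> R\<inverse> `` (A\<inverse> `` U)"
  proof
    fix w assume "w \<in> A\<inverse> `` U"
    then obtain p where p: "(w, p) \<in> A" "p \<in> U" by blast
    then obtain p' where p': "(p, p') \<in> S" "p' \<in> U" using U(2) by blast
    obtain u u' where u: "(u, p) \<in> A" "(u', p') \<in> B" using p'(1) by (rule S_E)
    show "w \<in> R\<inverse> `` (A\<inverse> `` U)"
      using R_I[OF p'(1) p(1) u(2)] B_A[OF u(2)] p'(2) by blast
  qed
qed

lemma Range_S_subset: "Range S \<subseteq> Range B"
  by (auto elim: S_E)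

text \<open>
An element \<open>p\<close> of \<open>U\<close> lies in the range of \<open>S\<close>, hence has some partner \<open>u\<close> under \<open>B\<close>. Another partner
\<open>w\<close> under \<open>A\<close> differs from \<open>u\<close> by an element of the fibre of \<open>A\<close> over \<open>0\<close>, which is the fibre of
\<open>B\<close>; so \<open>w\<close> is a partner under \<open>B\<close> too.
\<close>

lemma pullbacks_eq_if_Range:
  assumes "U \<subseteq> Range S" and fib: "{w. (w, 0) \<in> A} = {w. (w, 0) \<in> B}"
  shows "A\<inverse> `` U = B\<inverse> `` U"
proof
  show "A\<inverse> `` U \<subseteq> B\<inverse> `` U"
  proof
    fix w assume "w \<in> A\<inverse> `` U"
    then obtain p where p: "(w, p) \<in> A" "p \<in> U" by blast
    obtain u where u: "(u, p) \<in> B" using assms(1) p(2) Range_S_subset by blast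
    have "(w - u, 0) \<in> A" using rel_diff[OF subA p(1) B_A[OF u]] by simp
    then have "(w - u, 0) \<in> B" using fib by blast
    then have "(w, p) \<in> B" using rel_add[OF subB _ u] by fastforce
    then show "w \<in> B\<inverse> `` U" using p(2) by blast
  qed
qed (use B_A in blast)

lemma pullback_in_Range:
  assumes "U \<subseteq> Range S"
  shows "B\<inverse> `` U \<subseteq> Range R"
proof
  fix w assume "w \<in> B\<inverse> `` U"
  then obtain p where p: "(w, p) \<in> B" "p \<in> U" by blast
  then obtain q where q: "(q, p) \<in> S" using assms by blast
  obtain u where "(u, q) \<in> A" using q by (blast elim: S_E)
  then show "w \<in> Range R" using R_I[OF q _ p(1)] by blast
qed

text \<open>
Every element of \<open>U\<close> is a value of \<open>B\<close>, and so of \<open>A\<close>, at some element of \<open>T\<close>. Given a pair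
that is linked to a sum in the enlarged relation, subtracting such partners on both sides leaves a
pair that is linked to the summand in the original relation \<open>R\<close> or \<open>S\<close>.
\<close>

lemma linked_sum:
  assumes U: "U \<subseteq> Range S"
  defines "T \<equiv> B\<inverse> `` U"
  shows "linked (R + T \<times> T) (S + U \<times> U) A B"
proof -
  have lift: "\<exists>w\<in>T. (w, p) \<in> B" if "p \<in> U" for p
    using that U Range_S_subset unfolding T_def by blast
  have "R + T \<times> T = A O (S + U \<times> U) O B\<inverse>"
  proof (intro set_eqI iffI; clarify)
    fix a b assume "(a, b) \<in> R + T \<times> T"
    then obtain w w' t t' where e: "a = w + t" "b = w' + t'" and
      r: "(w, w') \<in> R" "t \<in> T" "t' \<in> T" by (auto elim!: set_plus_elim)
    obtain p p' where pp: "(p, p') \<in> S" "(w, p) \<in> A" "(w', p') \<in> B" using r(1) by (rule R_E)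
    obtain q q' where q: "(t, q) \<in> B" "q \<in> U" "(t', q') \<in> B" "q' \<in> U"
      using r unfolding T_def by blast
    have "(a, p + q) \<in> A" "(b, p' + q') \<in> B"
      unfolding e using rel_add[OF subA pp(2) B_A[OF q(1)]] rel_add[OF subB pp(3) q(3)] by auto
    moreover have "(p + q, p' + q') \<in> S + U \<times> U"
      using set_plus_intro[OF pp(1), of "(q, q')" "U \<times> U"] q by simp
    ultimately show "(a, b) \<in> A O (S + U \<times> U) O B\<inverse>" by blast
  next
    fix w x x' w'
    assume "(x, x') \<in> S + U \<times> U" and w: "(w, x) \<in> A" "(w', x') \<in> B"
    then obtain p p' q q' where e: "x = p + q" "x' = p' + q'" and
      pp: "(p, p') \<in> S" "q \<in> U" "q' \<in> U" by (auto elim!: set_plus_elim)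
    obtain t t' where t: "t \<in> T" "(t, q) \<in> B" "t' \<in> T" "(t', q') \<in> B" using lift pp by meson
    have "(w - t, p) \<in> A" "(w' - t', p') \<in> B"
      using rel_diff[OF subA w(1) B_A[OF t(2)]] rel_diff[OF subB w(2) t(4)] unfolding e by auto
    then have "(w - t, w' - t') \<in> R" using R_I pp(1) by blast
    from set_plus_intro[OF this, of "(t, t')" "T \<times> T"]
    show "(w, w') \<in> R + T \<times> T" using t by simp
  qed
  moreover have "S + U \<times> U = A\<inverse> O (R + T \<times> T) O B"
  proof (intro set_eqI iffI; clarify)
    fix a b assume "(a, b) \<in> S + U \<times> U"
    then obtain p p' q q' where e: "a = p + q" "b = p' + q'" and
      r: "(p, p') \<in> S" "q \<in> U" "q' \<in> U" by (auto elim!: set_plus_elim)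
    obtain w w' where ww: "(w, w') \<in> R" "(w, p) \<in> A" "(w', p') \<in> B" using r(1) by (rule S_E)
    obtain t t' where t: "t \<in> T" "(t, q) \<in> B" "t' \<in> T" "(t', q') \<in> B" using lift r by meson
    have "(w + t, a) \<in> A" "(w' + t', b) \<in> B"
      unfolding e using rel_add[OF subA ww(2) B_A[OF t(2)]] rel_add[OF subB ww(3) t(4)] by auto
    moreover have "(w + t, w' + t') \<in> R + T \<times> T"
      using set_plus_intro[OF ww(1), of "(t, t')" "T \<times> T"] t by simp
    ultimately show "(a, b) \<in> A\<inverse> O (R + T \<times> T) O B" by blast
  next
    fix p x x' p'
    assume "(x, x') \<in> R + T \<times> T" and p: "(x, p) \<in> A" "(x', p') \<in> B"
    then obtain w w' t t' where e: "x = w + t" "x' = w' + t'" and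
      ww: "(w, w') \<in> R" "t \<in> T" "t' \<in> T" by (auto elim!: set_plus_elim)
    obtain q q' where q: "(t, q) \<in> B" "q \<in> U" "(t', q') \<in> B" "q' \<in> U"
      using ww unfolding T_def by blast
    have "(w, p - q) \<in> A" "(w', p' - q') \<in> B"
      using rel_diff[OF subA p(1) B_A[OF q(1)]] rel_diff[OF subB p(2) q(3)] unfolding e by auto
    then have "(p - q, p' - q') \<in> S" using S_I ww(1) by blast
    from set_plus_intro[OF this, of "(q, q')" "U \<times> U"]
    show "(p, p') \<in> S + U \<times> U" using q by simp
  qed
  ultimately show ?thesis using linked unfolding linked_def by blast
qed

text \<open>
Two values of \<open>A\<close> at \<open>w\<close> differ by an element of the
zero fibre of \<open>S\<close>, so membership in \<open>U\<close> of one value implies that of all.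
\<close>

lemma A_values_in:
  assumes U: "add_subgroup U" "{p. (p, 0) \<in> S} \<subseteq> U"
    and "w \<in> A\<inverse> `` U" "(w, x) \<in> A"
  shows "x \<in> U"
proof -
  obtain p where p: "p \<in> U" "(w, p) \<in> A" using assms(3) by blast
  have "x - p \<in> U" using A_two_values[OF assms(4) p(2)] U(2) by blast
  then show ?thesis using add_subgroup_add[OF U(1) _ p(1)] by fastforce
qed

lemma pullbacks_eq_if_Domain:
  assumes U: "add_subgroup U" "{p. (p, 0) \<in> S} \<subseteq> U" and dom: "Domain A = Domain B"
  shows "A\<inverse> `` U = B\<inverse> `` U"
proof
  show "A\<inverse> `` U \<subseteq> B\<inverse> `` U"
  proof
    fix w assume w: "w \<in> A\<inverse> `` U"
    then obtain q where q: "(w, q) \<in> B" using dom by blast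
    then show "w \<in> B\<inverse> `` U" using A_values_in[OF U w B_A[OF q]] by blast
  qed
qed (use B_A in blast)

text \<open>
The right entry \<open>0\<close> of a pair of \<open>R\<close> may correspond to a nonzero \<open>p'\<close>, but then \<open>(0, p')\<close> is in \<open>S\<close>
and can be subtracted.
\<close>

lemma fibre_in_pullback:
  assumes "{p. (p, 0) \<in> S} \<subseteq> U"
  shows "{w. (w, 0) \<in> R} \<subseteq> A\<inverse> `` U"
proof clarify
  fix w assume "(w, 0) \<in> R"
  then obtain p p' where p: "(p, p') \<in> S" "(w, p) \<in> A" "(0, p') \<in> B" by (rule R_E)
  have "(p, 0) \<in> S" using rel_diff[OF subS p(1) B_fibre_in_S[OF p(3)]] by simp
  then show "w \<in> A\<inverse> `` U" using assms p(2) by blast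
qed

text \<open>
By \<open>A_values_in\<close>, linked pairs of \<open>R\<close> and \<open>S\<close> have their left entries in \<open>T\<close> and \<open>U\<close>
simultaneously, and because \<open>B \<subseteq> A\<close> the same is true of the right entries. Thus restricting one
relation restricts the other.
\<close>

lemma linked_Int:
  assumes U: "add_subgroup U" "{p. (p, 0) \<in> S} \<subseteq> U"
  defines "T \<equiv> A\<inverse> `` U"
  shows "linked (R \<inter> T \<times> T) (S \<inter> U \<times> U) A B"
proof -
  have T: "x \<in> U" if "w \<in> T" "(w, x) \<in> A" for w x
    using A_values_in[OF U] that unfolding T_def by blast
  have "R \<inter> T \<times> T = A O (S \<inter> U \<times> U) O B\<inverse>"
  proof (intro set_eqI iffI; clarify)
    fix w w' assume w: "(w, w') \<in> R" "w \<in> T" "w' \<in> T"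
    obtain p p' where "(p, p') \<in> S" "(w, p) \<in> A" "(w', p') \<in> B" using w(1) by (rule R_E)
    moreover from this have "p \<in> U" "p' \<in> U" using T w B_A by blast+
    ultimately show "(w, w') \<in> A O (S \<inter> U \<times> U) O B\<inverse>" by blast
  next
    fix w p p' w'
    assume "(w, p) \<in> A" "(p, p') \<in> S" "p \<in> U" "p' \<in> U" "(w', p') \<in> B"
    then show "(w, w') \<in> R \<inter> T \<times> T" using R_I B_A unfolding T_def by blast
  qed
  moreover have "S \<inter> U \<times> U = A\<inverse> O (R \<inter> T \<times> T) O B"
  proof (intro set_eqI iffI; clarify)
    fix p p' assume p: "(p, p') \<in> S" "p \<in> U" "p' \<in> U"
    obtain w w' where w: "(w, w') \<in> R" "(w, p) \<in> A" "(w', p') \<in> B" using p(1) by (rule S_E)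
    moreover from w p have "w \<in> T" "w' \<in> T" using B_A unfolding T_def by blast+
    ultimately show "(p, p') \<in> A\<inverse> O (R \<inter> T \<times> T) O B" by blast
  next
    fix p w w' p'
    assume a: "(w, p) \<in> A" "(w, w') \<in> R" "w \<in> T" "w' \<in> T" "(w', p') \<in> B"
    then show "(p, p') \<in> S \<inter> U \<times> U" using S_I T B_A by blast
  qed
  ultimately show ?thesis using linked unfolding linked_def by blast
qed

end

section \<open>Vectors on disjoint index sets\<close>

lemma zero_in_vecs: "0 \<in> vecs X"
  by (simp add: vecs_def)

lemma add_in_vecs: "f \<in> vecs X \<Longrightarrow> g \<in> vecs X \<Longrightarrow> f + g \<in> vecs X"
  by (simp add: vecs_def)

lemma vecs_mono: "X \<subseteq> Y \<Longrightarrow> vecs X \<subseteq> vecs Y"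
  by (auto simp: vecs_def)

lemma restr_in_vecs: "restr X f \<in> vecs X"
  by (simp add: vecs_def restr_def)

lemma sum_in_vecs: "f \<in> vecs X \<Longrightarrow> g \<in> vecs Y \<Longrightarrow> f + g \<in> vecs (X \<union> Y)"
  by (simp add: vecs_def)

lemma restr_sum:
  assumes "X \<inter> Y = {}" "f \<in> vecs X" "g \<in> vecs Y"
  shows "restr X (f + g) = f" "restr Y (f + g) = g"
  using assms by (auto simp: fun_eq_iff restr_def vecs_def)

lemma vecs_split:
  assumes "h \<in> vecs (X \<union> Y)" "X \<inter> Y = {}"
  shows "h = restr X h + restr Y h"
  using assms by (auto simp: fun_eq_iff restr_def vecs_def)

text \<open>
For linkages and invariance, one of the two index sets of a matching contains the other. The matched
space is then the preimage \<open>U\<inverse> `` V\<close> of \<open>V\<close> when \<open>U\<close> is read as a relation between vectors on \<open>X\<close> and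
vectors on \<open>Y\<close>.
\<close>

lemma matched_contained:
  assumes disj: "X \<inter> Y = {}" and V: "V \<subseteq> vecs Y" and U: "U \<subseteq> vecs (X \<union> Y)"
  shows "matched Y V (X \<union> Y) U = {f \<in> vecs X. \<exists>g\<in>V. f + g \<in> U}" (is "?L = ?M")
    and "matched (X \<union> Y) U Y V = {f \<in> vecs X. \<exists>g\<in>V. f + g \<in> U}"
proof -
  have eq: "Y - (X \<union> Y) = {}" "X \<union> Y - Y = X" "Y \<inter> (X \<union> Y) = Y" "(X \<union> Y) \<inter> Y = Y"
    and emp: "restr {} g = 0" for g :: "'a \<Rightarrow> 'f :: field"
    using disj by (auto simp: restr_def fun_eq_iff)
  have L: "?L = {restr X h | g h. g \<in> V \<and> h \<in> U \<and> (\<forall>i\<in>Y. g i = h i)}"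
    unfolding matched_def eq emp by simp
  also have "\<dots> = ?M"
  proof (intro set_eqI iffI)
    fix f assume "f \<in> {restr X h | g h. g \<in> V \<and> h \<in> U \<and> (\<forall>i\<in>Y. g i = h i)}"
    then obtain g h where gh: "f = restr X h" "g \<in> V" "h \<in> U" "\<forall>i\<in>Y. g i = h i" by blast
    have "g \<in> vecs Y" "h \<in> vecs (X \<union> Y)" using gh V U by blast+
    then have "f + g = h"
      using gh(4) disj by (auto simp: gh(1) fun_eq_iff restr_def vecs_def)
    then have "f + g \<in> U" using gh(3) by simp
    moreover have "f \<in> vecs X" unfolding gh(1) by (rule restr_in_vecs)
    ultimately show "f \<in> ?M" using gh(2) by blast
  next
    fix f assume "f \<in> ?M"
    then obtain g where g: "f \<in> vecs X" "g \<in> V" "f + g \<in> U" by blast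
    have "restr X (f + g) = f" using restr_sum(1)[OF disj g(1)] g(2) V by blast
    moreover have "\<forall>i\<in>Y. g i = (f + g) i" using g(1) disj by (auto simp: vecs_def)
    ultimately show "f \<in> {restr X h | g h. g \<in> V \<and> h \<in> U \<and> (\<forall>i\<in>Y. g i = h i)}"
      using g(2,3) by (intro CollectI exI[of _ g] exI[of _ "f + g"]) simp
  qed
  finally show "?L = ?M" .
  have "matched (X \<union> Y) U Y V = ?L"
    unfolding L unfolding matched_def eq emp add_0_right
  proof (intro Collect_cong iffI; elim exE conjE)
    fix f g h
    show "\<exists>g h. f = restr X h \<and> g \<in> V \<and> h \<in> U \<and> (\<forall>i\<in>Y. g i = h i)"
      if "f = restr X g" "g \<in> U" "h \<in> V" "\<forall>i\<in>Y. g i = h i"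
      using that by (intro exI[of _ h] exI[of _ g]) simp
    show "\<exists>g h. f = restr X g \<and> g \<in> U \<and> h \<in> V \<and> (\<forall>i\<in>Y. g i = h i)"
      if "f = restr X h" "g \<in> V" "h \<in> U" "\<forall>i\<in>Y. g i = h i"
      using that by (intro exI[of _ h] exI[of _ g]) simp
  qed
  then show "matched (X \<union> Y) U Y V = ?M" using \<open>?L = ?M\<close> by simp
qed

definition pair_rel :: "'a set \<Rightarrow> 'a set \<Rightarrow> ('a \<Rightarrow> 'f :: field) set \<Rightarrow> (('a \<Rightarrow> 'f) \<times> ('a \<Rightarrow> 'f)) set" where
  "pair_rel X Y V = {(f, g). f \<in> vecs X \<and> g \<in> vecs Y \<and> f + g \<in> V}"

lemma pair_rel_converse: "pair_rel Y X V = (pair_rel X Y V)\<inverse>"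
  by (auto simp: pair_rel_def add.commute)

lemma pair_rel_subset_iff:
  assumes "X \<inter> Y = {}" "V \<subseteq> vecs (X \<union> Y)"
  shows "pair_rel X Y V \<subseteq> pair_rel X Y U \<longleftrightarrow> V \<subseteq> U"
proof
  assume sub: "pair_rel X Y V \<subseteq> pair_rel X Y U"
  show "V \<subseteq> U"
  proof
    fix h assume h: "h \<in> V"
    have e: "h = restr X h + restr Y h" using vecs_split assms h by blast
    then have "(restr X h, restr Y h) \<in> pair_rel X Y V"
      using h by (simp add: pair_rel_def restr_in_vecs)
    then have "restr X h + restr Y h \<in> U" using sub by (auto simp: pair_rel_def)
    then show "h \<in> U" using e by simp
  qed
qed (auto simp: pair_rel_def)

lemma matched_eq_Image:
  assumes "X \<inter> Y = {}" "V \<subseteq> vecs Y" "U \<subseteq> vecs (X \<union> Y)"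
  shows "matched (X \<union> Y) U Y V = (pair_rel X Y U)\<inverse> `` V"
  unfolding matched_contained(2)[OF assms] pair_rel_def using assms(2) by blast

lemma vcontract_eq: "vcontract V X = {f. (f, 0) \<in> pair_rel X Y V}"
  by (auto simp: vcontract_def pair_rel_def zero_in_vecs)

lemma vrestrict_eq:
  assumes "X \<inter> Y = {}" "V \<subseteq> vecs (X \<union> Y)"
  shows "vrestrict V X = Domain (pair_rel X Y V)"
proof (intro set_eqI iffI)
  fix f assume "f \<in> vrestrict V X"
  then obtain h where h: "h \<in> V" "f = restr X h" by (auto simp: vrestrict_def)
  have "h = restr X h + restr Y h" using vecs_split assms h by blast
  then have "(f, restr Y h) \<in> pair_rel X Y V"
    using h by (simp add: pair_rel_def restr_in_vecs)
  then show "f \<in> Domain (pair_rel X Y V)" by blast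
next
  fix f assume "f \<in> Domain (pair_rel X Y V)"
  then obtain g where g: "f \<in> vecs X" "g \<in> vecs Y" "f + g \<in> V" by (auto simp: pair_rel_def)
  then show "f \<in> vrestrict V X"
    using restr_sum(1)[OF assms(1) g(1,2)] by (auto simp: vrestrict_def intro!: exI[of _ "f + g"])
qed

lemma add_subgroup_subspace: "fun_vs.subspace V \<Longrightarrow> add_subgroup V"
  by (simp add: add_subgroup_def fun_vs.subspace_0 fun_vs.subspace_diff)

lemma add_subgroup_vecs: "add_subgroup (vecs X)"
  by (simp add: add_subgroup_def vecs_def)

lemma add_subgroup_pair_rel:
  assumes "add_subgroup V"
  shows "add_subgroup (pair_rel X Y V)"
proof -
  have "f + g - (f' + g') \<in> V" if "f + g \<in> V" "f' + g' \<in> V" for f g f' g'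
    using add_subgroup_diff[OF assms that] .
  then have "f - f' + (g - g') \<in> V" if "f + g \<in> V" "f' + g' \<in> V" for f g f' g'
    using that by (metis add_diff_add)
  then show ?thesis
    using add_subgroup_zero[OF assms] unfolding add_subgroup_def pair_rel_def
    by (auto simp: zero_prod_def zero_in_vecs add_subgroup_diff[OF add_subgroup_vecs])
qed

lemma vspace_pullback:
  assumes "vspace (X \<union> Y) V" "vspace Y U"
  shows "vspace X ((pair_rel X Y V)\<inverse> `` U)"
proof -
  have V: "fun_vs.subspace V" and U: "fun_vs.subspace U" using assms by (auto simp: vspace_def)
  let ?T = "(pair_rel X Y V)\<inverse> `` U"
  have "fun_vs.subspace ?T"
  proof (rule fun_vs.subspaceI)
    have "(0, 0) \<in> pair_rel X Y V"
      by (rule rel_zero[OF add_subgroup_pair_rel[OF add_subgroup_subspace[OF V]]])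
    then show "0 \<in> ?T" using fun_vs.subspace_0[OF U] by blast
  next
    fix f f' assume "f \<in> ?T" "f' \<in> ?T"
    then obtain g g' where g: "(f, g) \<in> pair_rel X Y V" "(f', g') \<in> pair_rel X Y V" "g \<in> U" "g' \<in> U"
      by blast
    then show "f + f' \<in> ?T"
      using rel_add[OF add_subgroup_pair_rel[OF add_subgroup_subspace[OF V]] g(1,2)]
        fun_vs.subspace_add[OF U g(3,4)] by blast
  next
    fix c f assume "f \<in> ?T"
    then obtain g where g: "f \<in> vecs X" "g \<in> vecs Y" "f + g \<in> V" "g \<in> U"
      by (auto simp: pair_rel_def)
    have "(\<lambda>i. c * (f + g) i) \<in> V" by (rule fun_vs.subspace_scale[OF V g(3)])
    moreover have "(\<lambda>i. c * (f + g) i) = (\<lambda>i. c * f i) + (\<lambda>i. c * g i)"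
      by (simp add: fun_eq_iff algebra_simps)
    ultimately have "((\<lambda>i. c * f i), (\<lambda>i. c * g i)) \<in> pair_rel X Y V"
      using g by (simp add: pair_rel_def vecs_def)
    then show "(\<lambda>i. c * f i) \<in> ?T" using fun_vs.subspace_scale[OF U g(4)] by blast
  qed
  then show ?thesis by (auto simp: vspace_def pair_rel_def)
qed

lemma inj_on_image_subset_iff:
  assumes "inj_on f C" "A \<subseteq> C" "B \<subseteq> C"
  shows "f ` A \<subseteq> f ` B \<longleftrightarrow> A \<subseteq> B"
  using assms unfolding inj_on_def by blast

lemma vspace_direct_sum:
  assumes "vspace X V" "vspace Y U"
  shows "vspace (X \<union> Y) (V \<oplus> U)"
proof -
  have "f + g \<in> vecs (X \<union> Y)" if "f \<in> V" "g \<in> U" for f g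
    using that assms by (intro sum_in_vecs) (auto simp: vspace_def)
  then show ?thesis
    using assms fun_vs.subspace_sums[of V U] by (auto simp: vspace_def direct_sum_def)
qed

lemma set_plus_eq_direct_sum: "V + U = V \<oplus> U"
  by (auto simp: set_plus_def direct_sum_def)

lemma vspace_plus: "vspace X V \<Longrightarrow> vspace X U \<Longrightarrow> vspace X (V + U)"
  using vspace_direct_sum[of X V X U] by (simp add: set_plus_eq_direct_sum)

lemma vspace_Int: "vspace X V \<Longrightarrow> vspace X U \<Longrightarrow> vspace X (V \<inter> U)"
  by (auto simp: vspace_def fun_vs.subspace_inter)

section \<open>Dotted copies of vectors\<close>

text \<open>
One index set \<open>I\<close> plays the part of \<open>W \<union> P\<close>, so that a single linear map \<open>dotted\<close> moves vectors on
any subset of \<open>I\<close> to its copy and the roles of \<open>W\<close> and \<open>P\<close> stay symmetric.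
\<close>

locale dotted_copy =
  fixes dot :: "'a \<Rightarrow> 'a" and I :: "'a set"
  assumes inj: "inj_on dot I" and I_disj: "I \<inter> dot ` I = {}"
begin

definition dotted :: "('a \<Rightarrow> 'f :: field) \<Rightarrow> 'a \<Rightarrow> 'f" where
  "dotted f = (\<lambda>j. if j \<in> dot ` I then f (inv_into I dot j) else 0)"

lemma dotted_dot: "i \<in> I \<Longrightarrow> dotted f (dot i) = f i"
  using inj by (simp add: dotted_def)

lemma dotted_outside: "j \<notin> dot ` I \<Longrightarrow> dotted f j = 0"
  by (simp add: dotted_def)

lemma dotted_add: "dotted (f + g) = dotted f + dotted g"
  by (simp add: dotted_def fun_eq_iff)

lemma dotted_diff: "dotted (f - g) = dotted f - dotted g"
  by (simp add: dotted_def fun_eq_iff)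

lemma dotted_0: "dotted 0 = 0"
  by (simp add: dotted_def fun_eq_iff)

lemma dotted_scale: "dotted (\<lambda>i. c * f i) = (\<lambda>i. c * dotted f i)"
  by (simp add: dotted_def fun_eq_iff)

lemma dotted_in_vecs:
  assumes "X \<subseteq> I" "f \<in> vecs X"
  shows "dotted f \<in> vecs (dot ` X)"
  unfolding vecs_def mem_Collect_eq
proof (intro allI impI)
  fix j assume j: "j \<notin> dot ` X"
  show "dotted f j = 0"
  proof (cases "j \<in> dot ` I")
    case True
    then obtain i where "i \<in> I" "j = dot i" by blast
    then show ?thesis using j assms(2) by (auto simp: dotted_dot vecs_def)
  qed (rule dotted_outside)
qed

lemma dotted_eq_iff:
  assumes "f \<in> vecs I" "g \<in> vecs I"
  shows "dotted f = dotted g \<longleftrightarrow> f = g"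
proof
  assume eq: "dotted f = dotted g"
  show "f = g"
  proof
    fix i show "f i = g i"
      using assms fun_cong[OF eq, of "dot i"] by (cases "i \<in> I") (auto simp: dotted_dot vecs_def)
  qed
qed simp

lemma inj_dotted: "inj_on dotted (vecs I)"
  by (rule inj_onI) (simp add: dotted_eq_iff)

lemma vecs_dot_image:
  assumes "X \<subseteq> I"
  shows "vecs (dot ` X) = dotted ` vecs X"
proof
  show "dotted ` vecs X \<subseteq> vecs (dot ` X)" using dotted_in_vecs[OF assms] by blast
  show "vecs (dot ` X) \<subseteq> dotted ` vecs X"
  proof
    fix g :: "'a \<Rightarrow> 'f :: field" assume g: "g \<in> vecs (dot ` X)"
    let ?f = "\<lambda>i. if i \<in> X then g (dot i) else 0"
    have f: "?f \<in> vecs X" by (simp add: vecs_def)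
    have "g j = dotted ?f j" for j
    proof (cases "j \<in> dot ` X")
      case True
      then show ?thesis using assms by (auto simp: dotted_dot)
    next
      case False
      then show ?thesis using g dotted_in_vecs[OF assms f] by (simp add: vecs_def)
    qed
    then show "g \<in> dotted ` vecs X" using f by blast
  qed
qed

lemma relabel_eq_image:
  assumes "X \<subseteq> I" "V \<subseteq> vecs X"
  shows "relabel dot X V = dotted ` V"
proof (intro set_eqI iffI)
  fix g assume "g \<in> relabel dot X V"
  then obtain f f' where f: "f \<in> V" "\<forall>x\<in>X. g (dot x) = f x" and f': "f' \<in> vecs X" "g = dotted f'"
    unfolding relabel_def vecs_dot_image[OF assms(1)] by blast
  have "f' = f"
  proof
    fix i show "f' i = f i"
    proof (cases "i \<in> X")
      case True
      then show ?thesis using f(2) assms(1) by (auto simp: f'(2) dotted_dot subset_iff)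
    next
      case False
      then show ?thesis using f(1) f'(1) assms(2) by (auto simp: vecs_def subset_iff)
    qed
  qed
  then show "g \<in> dotted ` V" using f f' by blast
next
  fix g assume "g \<in> dotted ` V"
  then show "g \<in> relabel dot X V"
    using assms dotted_in_vecs[OF assms(1)] by (auto simp: relabel_def dotted_dot subset_iff)
qed

definition undotted :: "('a \<Rightarrow> 'f :: field) set \<Rightarrow> ('a \<Rightarrow> 'f) set" where
  "undotted V = {f \<in> vecs I. dotted f \<in> V}"

lemma relabel_inv_eq_undotted:
  fixes V :: "('a \<Rightarrow> 'f :: field) set"
  assumes "V \<subseteq> vecs (dot ` I)"
  shows "relabel (inv_into I dot) (dot ` I) V = undotted V"
proof -
  have im: "inv_into I dot ` dot ` I = I" using inj by simp
  have "g = dotted f" if "g \<in> V" "\<forall>x\<in>dot ` I. f (inv_into I dot x) = g x" for f g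
    using that assms by (auto simp: fun_eq_iff dotted_def vecs_def)
  moreover have "\<forall>x\<in>dot ` I. f (inv_into I dot x) = dotted f x" for f :: "'a \<Rightarrow> 'f"
    by (simp add: dotted_def)
  ultimately show ?thesis
    unfolding relabel_def undotted_def im by (intro Collect_cong conj_cong refl) metis
qed

lemma undotted_subset: "undotted V \<subseteq> vecs I"
  by (auto simp: undotted_def)

text \<open>
Using undotted vectors for both entries makes these relations composable with \<open>pair_rel X Y V\<close> on
either side.
\<close>

definition dot_rel :: "'a set \<Rightarrow> ('a \<Rightarrow> 'f :: field) set \<Rightarrow> (('a \<Rightarrow> 'f) \<times> ('a \<Rightarrow> 'f)) set" where
  "dot_rel X V = {(f, g). f \<in> vecs X \<and> g \<in> vecs X \<and> f + dotted g \<in> V}"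

lemma copy_disj: "X \<subseteq> I \<Longrightarrow> Y \<subseteq> I \<Longrightarrow> X \<inter> dot ` Y = {}"
  using I_disj by blast

lemma dotted_sum_eq_iff:
  assumes "f \<in> vecs I" "g \<in> vecs I" "f' \<in> vecs I" "g' \<in> vecs I"
  shows "f + dotted g = f' + dotted g' \<longleftrightarrow> f = f' \<and> g = g'"
  using assms restr_sum[OF I_disj _ dotted_in_vecs[OF subset_refl]] dotted_eq_iff by metis

lemma dotted_sum_decomp:
  assumes "X \<subseteq> I" "h \<in> vecs (X \<union> dot ` X)"
  obtains f g where "f \<in> vecs X" "g \<in> vecs X" "h = f + dotted g"
proof -
  have "restr (dot ` X) h \<in> dotted ` vecs X"
    using restr_in_vecs vecs_dot_image[OF assms(1)] by metis
  then show ?thesis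
    using that vecs_split[OF assms(2) copy_disj[OF assms(1) assms(1)]] restr_in_vecs by (metis imageE)
qed

lemma pair_rel_copy_eq:
  assumes "X \<subseteq> I"
  shows "pair_rel X (dot ` X) V = {(f, dotted g) | f g. (f, g) \<in> dot_rel X V}"
  unfolding pair_rel_def dot_rel_def vecs_dot_image[OF assms] by blast

lemma dot_rel_eq_iff:
  assumes "X \<subseteq> I" "V \<subseteq> vecs (X \<union> dot ` X)" "V' \<subseteq> vecs (X \<union> dot ` X)"
  shows "dot_rel X V = dot_rel X V' \<longleftrightarrow> V = V'"
proof
  assume "dot_rel X V = dot_rel X V'"
  then have "pair_rel X (dot ` X) V = pair_rel X (dot ` X) V'"
    by (simp add: pair_rel_copy_eq[OF assms(1)])
  then show "V = V'"
    using pair_rel_subset_iff[OF copy_disj[OF assms(1) assms(1)]] assms(2,3) by blast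
qed simp

lemma add_subgroup_dot_rel:
  assumes "add_subgroup V"
  shows "add_subgroup (dot_rel X V)"
proof -
  have "f - f' + dotted (g - g') \<in> V" if "f + dotted g \<in> V" "f' + dotted g' \<in> V" for f g f' g'
    using add_subgroup_diff[OF assms that] by (simp add: dotted_diff add_diff_add)
  then show ?thesis
    using add_subgroup_zero[OF assms] unfolding add_subgroup_def dot_rel_def
    by (auto simp: zero_prod_def zero_in_vecs add_subgroup_diff[OF add_subgroup_vecs] dotted_0)
qed

lemma add_subgroup_undotted:
  assumes "add_subgroup V"
  shows "add_subgroup (undotted V)"
  using assms unfolding add_subgroup_def undotted_def
  by (auto simp: zero_in_vecs add_subgroup_diff[OF add_subgroup_vecs] dotted_0 dotted_diff)

lemma direct_sum_iff:
  assumes "V1 \<subseteq> vecs I" "V2 \<subseteq> vecs (dot ` I)" "f \<in> vecs I" "g \<in> vecs I"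
  shows "f + dotted g \<in> V1 \<oplus> V2 \<longleftrightarrow> f \<in> V1 \<and> g \<in> undotted V2"
proof
  assume "f + dotted g \<in> V1 \<oplus> V2"
  then obtain a b where ab: "a \<in> V1" "b \<in> V2" "f + dotted g = a + b" by (auto simp: direct_sum_def)
  then obtain b' where b': "b' \<in> vecs I" "b = dotted b'"
    using assms(2) vecs_dot_image[OF subset_refl] by blast
  have "f = a \<and> g = b'" using dotted_sum_eq_iff ab b' assms by blast
  then show "f \<in> V1 \<and> g \<in> undotted V2" using ab b' by (simp add: undotted_def)
qed (auto simp: direct_sum_def undotted_def)

text \<open>
A vector \<open>x + dotted x'\<close> belongs to the matched space iff some \<open>y + dotted y'\<close> in \<open>V\<close> satisfies
\<open>x + dotted x' + (y + dotted y') \<in> V1 \<oplus> V2\<close>. Regrouping the four summands separates this condition into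
\<open>x + y \<in> V1\<close> and \<open>dotted (x' + y') \<in> V2\<close>, which is the stated composition.
\<close>

lemma dot_rel_matched:
  assumes XY: "X \<union> Y = I" "X \<inter> Y = {}" and V: "V \<subseteq> vecs (Y \<union> dot ` Y)"
    and V1: "V1 \<subseteq> vecs I" and V2: "V2 \<subseteq> vecs (dot ` I)"
  shows "dot_rel X (matched (Y \<union> dot ` Y) V (I \<union> dot ` I) (V1 \<oplus> V2)) =
    pair_rel X Y V1 O dot_rel Y V O (pair_rel X Y (undotted V2))\<inverse>"
    and "matched (Y \<union> dot ` Y) V (I \<union> dot ` I) (V1 \<oplus> V2) \<subseteq> vecs (X \<union> dot ` X)"
proof -
  have sub: "X \<subseteq> I" "Y \<subseteq> I" using XY by auto
  have "dot ` X \<inter> dot ` Y = {}" using XY(2) inj_on_image_Int[OF inj sub] by simp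
  then have disj: "(X \<union> dot ` X) \<inter> (Y \<union> dot ` Y) = {}"
    using XY(2) copy_disj[OF sub] copy_disj[OF sub(2,1)] copy_disj[OF sub(1,1)] copy_disj[OF sub(2,2)]
    by (simp add: Int_Un_distrib Int_Un_distrib2 Int_commute)
  have I: "I \<union> dot ` I = (X \<union> dot ` X) \<union> (Y \<union> dot ` Y)"
    unfolding XY(1)[symmetric] image_Un by (simp add: ac_simps)
  have "f + g \<in> vecs (I \<union> dot ` I)" if "f \<in> V1" "g \<in> V2" for f g
    using that V1 V2 by (intro sum_in_vecs) auto
  then have sum: "V1 \<oplus> V2 \<subseteq> vecs ((X \<union> dot ` X) \<union> (Y \<union> dot ` Y))"
    unfolding I[symmetric] direct_sum_def by blast
  have m: "matched (Y \<union> dot ` Y) V (I \<union> dot ` I) (V1 \<oplus> V2) =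
      {f \<in> vecs (X \<union> dot ` X). \<exists>g\<in>V. f + g \<in> V1 \<oplus> V2}"
    by (simp only: I) (rule matched_contained(1)[OF disj V sum])
  then show "matched (Y \<union> dot ` Y) V (I \<union> dot ` I) (V1 \<oplus> V2) \<subseteq> vecs (X \<union> dot ` X)" by blast
  have key: "(x + dotted x') + (y + dotted y') \<in> V1 \<oplus> V2 \<longleftrightarrow>
      (x, y) \<in> pair_rel X Y V1 \<and> (x', y') \<in> pair_rel X Y (undotted V2)"
    if "x \<in> vecs X" "x' \<in> vecs X" "y \<in> vecs Y" "y' \<in> vecs Y" for x x' y y'
  proof -
    have eq: "(x + dotted x') + (y + dotted y') = (x + y) + dotted (x' + y')"
      by (simp add: dotted_add ac_simps)
    have "x + y \<in> vecs I" "x' + y' \<in> vecs I"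
      unfolding XY(1)[symmetric] using that by (auto intro: sum_in_vecs)
    from direct_sum_iff[OF V1 V2 this] show ?thesis
      unfolding eq using that by (simp add: pair_rel_def)
  qed
  show "dot_rel X (matched (Y \<union> dot ` Y) V (I \<union> dot ` I) (V1 \<oplus> V2)) =
    pair_rel X Y V1 O dot_rel Y V O (pair_rel X Y (undotted V2))\<inverse>"
  proof (intro set_eqI iffI; clarify)
    fix x x' assume "(x, x') \<in> dot_rel X (matched (Y \<union> dot ` Y) V (I \<union> dot ` I) (V1 \<oplus> V2))"
    then obtain v where v: "x \<in> vecs X" "x' \<in> vecs X" "v \<in> V" "x + dotted x' + v \<in> V1 \<oplus> V2"
      unfolding m dot_rel_def by blast
    then have "v \<in> vecs (Y \<union> dot ` Y)" using V by blast
    then obtain y y' where y: "y \<in> vecs Y" "y' \<in> vecs Y" "v = y + dotted y'"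
      by (rule dotted_sum_decomp[OF sub(2)])
    then have "(y, y') \<in> dot_rel Y V" using v(3) by (simp add: dot_rel_def)
    then show "(x, x') \<in> pair_rel X Y V1 O dot_rel Y V O (pair_rel X Y (undotted V2))\<inverse>"
      using key[OF v(1,2) y(1,2)] v(4)[unfolded y(3)] by (intro relcompI) auto
  next
    fix x y y' x'
    assume a: "(x, y) \<in> pair_rel X Y V1" "(y, y') \<in> dot_rel Y V"
      "(x', y') \<in> pair_rel X Y (undotted V2)"
    then have v: "x \<in> vecs X" "x' \<in> vecs X" "y \<in> vecs Y" "y' \<in> vecs Y" "y + dotted y' \<in> V"
      by (auto simp: pair_rel_def dot_rel_def)
    have "x + dotted x' \<in> vecs (X \<union> dot ` X)"
      by (rule sum_in_vecs[OF v(1) dotted_in_vecs[OF sub(1) v(2)]])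
    then have "x + dotted x' \<in> matched (Y \<union> dot ` Y) V (I \<union> dot ` I) (V1 \<oplus> V2)"
      unfolding m using key[OF v(1-4)] v(5) a(1,3) by (intro CollectI conjI bexI) auto
    then show "(x, x') \<in> dot_rel X (matched (Y \<union> dot ` Y) V (I \<union> dot ` I) (V1 \<oplus> V2))"
      using v by (simp add: dot_rel_def)
  qed
qed

text \<open>
The two matching conditions are the instances of \<open>dot_rel_matched\<close> for \<open>W\<close>, \<open>P\<close> and for \<open>P\<close>, \<open>W\<close>;
exchanging the index sets replaces each \<open>pair_rel\<close> by its converse.
\<close>

lemma E_linked_iff_linked:
  assumes "W \<union> P = I" "W \<inter> P = {}"
  shows "E_linked dot W (dot ` W) P (dot ` P) R S V1 V2 \<longleftrightarrow>
    vspace (W \<union> dot ` W) R \<and> vspace (P \<union> dot ` P) S \<and> vspace I V1 \<and> vspace (dot ` I) V2 \<and>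
    linked (dot_rel W R) (dot_rel P S) (pair_rel W P V1) (pair_rel W P (undotted V2))"
proof (cases "vspace (W \<union> dot ` W) R \<and> vspace (P \<union> dot ` P) S \<and> vspace I V1 \<and> vspace (dot ` I) V2")
  case True
  then have v: "R \<subseteq> vecs (W \<union> dot ` W)" "S \<subseteq> vecs (P \<union> dot ` P)" "V1 \<subseteq> vecs I" "V2 \<subseteq> vecs (dot ` I)"
    by (auto simp: vspace_def)
  have PW: "P \<union> W = I" "P \<inter> W = {}" using assms by auto
  have sub: "W \<subseteq> I" "P \<subseteq> I" using assms by auto
  have eqs1: "pair_rel W P (undotted V2) \<subseteq> pair_rel W P V1 \<longleftrightarrow> undotted V2 \<subseteq> V1"
    by (rule pair_rel_subset_iff[OF assms(2)]) (simp add: assms(1) undotted_subset)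
  have eqs2: "dot_rel W R = pair_rel W P V1 O dot_rel P S O (pair_rel W P (undotted V2))\<inverse> \<longleftrightarrow>
      R = matched (P \<union> dot ` P) S (I \<union> dot ` I) (V1 \<oplus> V2)"
    unfolding dot_rel_matched(1)[OF assms v(2-4), symmetric]
    by (rule dot_rel_eq_iff[OF sub(1) v(1) dot_rel_matched(2)[OF assms v(2-4)]])
  have eqs3: "dot_rel P S = (pair_rel W P V1)\<inverse> O dot_rel W R O pair_rel W P (undotted V2) \<longleftrightarrow>
      S = matched (W \<union> dot ` W) R (I \<union> dot ` I) (V1 \<oplus> V2)"
    unfolding dot_rel_matched(1)[OF PW v(1,3,4), unfolded pair_rel_converse[of P W] converse_converse, symmetric]
    by (rule dot_rel_eq_iff[OF sub(2) v(2) dot_rel_matched(2)[OF PW v(1,3,4)]])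
  have im: "dot ` W \<union> dot ` P = dot ` I" using assms(1) by blast
  show ?thesis
    unfolding E_linked_def linked_def eqs1 eqs2 eqs3 assms(1) im relabel_inv_eq_undotted[OF v(4)] by (rule refl)
next
  case False
  have im: "dot ` W \<union> dot ` P = dot ` I" using assms(1) by blast
  show ?thesis
    unfolding E_linked_def assms(1) im by (intro conj_cong refl) (use False in \<open>blast+\<close>)
qed

lemma invariant_in_iff:
  fixes U V :: "('a \<Rightarrow> 'f :: field) set"
  assumes X: "X \<subseteq> I"
  shows "invariant_in dot X (dot ` X) U V \<longleftrightarrow>
    vspace X U \<and> vspace (X \<union> dot ` X) V \<and>
    dot_rel X V `` U \<subseteq> U \<and> U \<subseteq> (dot_rel X V)\<inverse> `` U"
proof (cases "vspace X U \<and> vspace (X \<union> dot ` X) V")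
  case True
  then have v: "U \<subseteq> vecs X" "V \<subseteq> vecs (X \<union> dot ` X)" by (auto simp: vspace_def)
  have d: "X \<inter> dot ` X = {}" "dot ` X \<inter> X = {}" using copy_disj[OF X X] by auto
  have inj: "inj_on dotted (vecs X :: ('a \<Rightarrow> 'f) set)"
    using inj_dotted vecs_mono[OF X] by (rule inj_on_subset)
  have "matched (X \<union> dot ` X) V X U = {f \<in> dotted ` vecs X. \<exists>g\<in>U. f + g \<in> V}"
    using matched_contained(2)[OF d(2) v(1)] v(2) by (simp add: Un_commute vecs_dot_image[OF X])
  also have "\<dots> = dotted ` {f \<in> vecs X. \<exists>g\<in>U. g + dotted f \<in> V}"
    by (auto simp: add.commute intro!: imageI)
  also have "{f \<in> vecs X. \<exists>g\<in>U. g + dotted f \<in> V} = dot_rel X V `` U"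
    using v(1) by (auto simp: dot_rel_def)
  finally have "matched (X \<union> dot ` X) V X U = dotted ` (dot_rel X V `` U)" .
  moreover have "dotted ` (dot_rel X V `` U) \<subseteq> dotted ` U \<longleftrightarrow> dot_rel X V `` U \<subseteq> U"
    using v(1) by (intro inj_on_image_subset_iff[OF inj]) (auto simp: dot_rel_def)
  moreover have "matched (X \<union> dot ` X) V (dot ` X) (dotted ` U) = (dot_rel X V)\<inverse> `` U"
  proof -
    have "dotted ` U \<subseteq> vecs (dot ` X)" using v(1) dotted_in_vecs[OF X] by blast
    then have "matched (X \<union> dot ` X) V (dot ` X) (dotted ` U) =
        {f \<in> vecs X. \<exists>g\<in>dotted ` U. f + g \<in> V}"
      by (rule matched_contained(2)[OF d(1) _ v(2)])
    also have "\<dots> = (dot_rel X V)\<inverse> `` U"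
      using v(1) unfolding dot_rel_def by blast
    finally show ?thesis .
  qed
  ultimately show ?thesis
    using True unfolding invariant_in_def relabel_eq_image[OF X v(1)] by simp
qed (auto simp: invariant_in_def)

lemma relabel_subset_vrestrict_iff:
  fixes U V :: "('a \<Rightarrow> 'f :: field) set"
  assumes X: "X \<subseteq> I" and U: "U \<subseteq> vecs X" and V: "V \<subseteq> vecs (X \<union> dot ` X)"
  shows "relabel dot X U \<subseteq> vrestrict V (dot ` X) \<longleftrightarrow> U \<subseteq> Range (dot_rel X V)"
proof -
  have d: "dot ` X \<inter> X = {}" using copy_disj[OF X X] by auto
  have inj: "inj_on dotted (vecs X :: ('a \<Rightarrow> 'f) set)"
    using inj_dotted vecs_mono[OF X] by (rule inj_on_subset)
  have "vrestrict V (dot ` X) = Range (pair_rel X (dot ` X) V)"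
    using vrestrict_eq[OF d, of V] V by (simp add: Un_commute pair_rel_converse[of "dot ` X"])
  also have "\<dots> = dotted ` Range (dot_rel X V)"
    unfolding pair_rel_copy_eq[OF X] by blast
  finally have "vrestrict V (dot ` X) = dotted ` Range (dot_rel X V)" .
  then show ?thesis
    unfolding relabel_eq_image[OF X U]
    using U by (simp only:) (intro inj_on_image_subset_iff[OF inj]; auto simp: dot_rel_def)
qed

lemma vcontract_eq_dot_rel: "vcontract V X = {f. (f, 0) \<in> dot_rel X V}"
  by (auto simp: vcontract_def dot_rel_def zero_in_vecs dotted_0)

lemma pair_rel_undotted:
  assumes "X \<union> Y = I"
  shows "pair_rel X Y (undotted V) =
    {(f, g). f \<in> vecs X \<and> g \<in> vecs Y \<and> dotted f + dotted g \<in> V}"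
proof -
  have "f + g \<in> vecs I" if "f \<in> vecs X" "g \<in> vecs Y" for f g :: "'a \<Rightarrow> 'b"
    using sum_in_vecs[OF that] unfolding assms .
  then show ?thesis by (auto simp: pair_rel_def undotted_def dotted_add)
qed

lemma vcontract_dot:
  assumes "X \<union> Y = I"
  shows "vcontract V (dot ` X) = dotted ` {f. (f, 0) \<in> pair_rel X Y (undotted V)}"
proof -
  have "X \<subseteq> I" using assms by blast
  then show ?thesis
    unfolding vcontract_def vecs_dot_image[OF \<open>X \<subseteq> I\<close>] pair_rel_undotted[OF assms]
    by (auto simp: zero_in_vecs dotted_0)
qed

lemma vrestrict_dot:
  assumes "X \<union> Y = I" "X \<inter> Y = {}" "V \<subseteq> vecs (dot ` I)"
  shows "vrestrict V (dot ` X) = dotted ` Domain (pair_rel X Y (undotted V))"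
proof -
  have sub: "X \<subseteq> I" "Y \<subseteq> I" using assms by auto
  have d: "dot ` X \<inter> dot ` Y = {}" using inj_on_image_Int[OF inj sub] assms(2) by simp
  have "dot ` X \<union> dot ` Y = dot ` I" by (simp add: assms(1) flip: image_Un)
  then have "vrestrict V (dot ` X) = Domain (pair_rel (dot ` X) (dot ` Y) V)"
    using vrestrict_eq[OF d] assms(3) by simp
  also have "pair_rel (dot ` X) (dot ` Y) V =
      {(dotted f, dotted g) | f g. (f, g) \<in> pair_rel X Y (undotted V)}"
    unfolding pair_rel_undotted[OF assms(1)] unfolding pair_rel_def
      vecs_dot_image[OF sub(1)] vecs_dot_image[OF sub(2)] by auto
  finally show ?thesis by blast
qed

lemma dotted_image_eq_iff:
  assumes "U \<subseteq> vecs I" "U' \<subseteq> vecs I"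
  shows "dotted ` U = dotted ` U' \<longleftrightarrow> U = U'"
  by (rule inj_on_image_eq_iff[OF inj_dotted assms])

lemma matched_dot:
  assumes "X \<union> Y = I" "X \<inter> Y = {}" "V \<subseteq> vecs (dot ` I)" "U \<subseteq> vecs Y"
  shows "matched (dot ` X \<union> dot ` Y) V (dot ` Y) (dotted ` U) =
    dotted ` ((pair_rel X Y (undotted V))\<inverse> `` U)"
proof -
  have sub: "X \<subseteq> I" "Y \<subseteq> I" using assms by auto
  have d: "dot ` X \<inter> dot ` Y = {}" using inj_on_image_Int[OF inj sub] assms(2) by simp
  have im: "dot ` X \<union> dot ` Y = dot ` I" by (simp add: assms(1) flip: image_Un)
  have "dotted ` U \<subseteq> vecs (dot ` Y)" using assms(4) dotted_in_vecs[OF sub(2)] by blast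
  then have "matched (dot ` X \<union> dot ` Y) V (dot ` Y) (dotted ` U) =
      {f \<in> dotted ` vecs X. \<exists>g\<in>dotted ` U. f + g \<in> V}"
    using matched_contained(2)[OF d, of "dotted ` U" V] assms(3)
    unfolding im vecs_dot_image[OF sub(1)] by blast
  also have "\<dots> = dotted ` {f \<in> vecs X. \<exists>g\<in>U. dotted f + dotted g \<in> V}"
    by blast
  also have "{f \<in> vecs X. \<exists>g\<in>U. dotted f + dotted g \<in> V} =
      (pair_rel X Y (undotted V))\<inverse> `` U"
    using assms(4) unfolding pair_rel_undotted[OF assms(1)] by blast
  finally show ?thesis .
qed

lemma dot_rel_square:
  assumes "X \<subseteq> I" "U \<subseteq> vecs X"
  shows "dot_rel X (U \<oplus> dotted ` U) = U \<times> U"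
proof (intro set_eqI iffI; clarify)
  fix f g assume "(f, g) \<in> dot_rel X (U \<oplus> dotted ` U)"
  then obtain u u' where u: "f \<in> vecs X" "g \<in> vecs X" "u \<in> U" "u' \<in> U" "f + dotted g = u + dotted u'"
    by (auto simp: dot_rel_def direct_sum_def)
  moreover from this have "u \<in> vecs X" "u' \<in> vecs X" using assms(2) by auto
  moreover note vecs_mono[OF assms(1), THEN subsetD]
  ultimately have "f = u \<and> g = u'" using dotted_sum_eq_iff[of f g u u'] by blast
  then show "f \<in> U \<and> g \<in> U" using u by blast
next
  fix f g assume "f \<in> U" "g \<in> U"
  then show "(f, g) \<in> dot_rel X (U \<oplus> dotted ` U)"
    using assms(2) by (auto simp: dot_rel_def direct_sum_def)
qed

lemma dot_rel_Int: "dot_rel X (V \<inter> V') = dot_rel X V \<inter> dot_rel X V'"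
  by (auto simp: dot_rel_def)

lemma dot_rel_plus:
  assumes "X \<subseteq> I" "V \<subseteq> vecs (X \<union> dot ` X)" "V' \<subseteq> vecs (X \<union> dot ` X)"
  shows "dot_rel X (V + V') = dot_rel X V + dot_rel X V'"
proof (intro set_eqI iffI; clarify)
  fix f g assume "(f, g) \<in> dot_rel X (V + V')"
  then obtain v v' where fg: "f \<in> vecs X" "g \<in> vecs X" "v \<in> V" "v' \<in> V'" "f + dotted g = v + v'"
    by (auto simp: dot_rel_def set_plus_def)
  obtain a b where ab: "a \<in> vecs X" "b \<in> vecs X" "v = a + dotted b"
    using dotted_sum_decomp[OF assms(1) subsetD[OF assms(2) fg(3)]] .
  obtain a' b' where ab': "a' \<in> vecs X" "b' \<in> vecs X" "v' = a' + dotted b'"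
    using dotted_sum_decomp[OF assms(1) subsetD[OF assms(3) fg(4)]] .
  have "f + dotted g = (a + a') + dotted (b + b')"
    unfolding fg(5) ab(3) ab'(3) by (simp add: dotted_add ac_simps)
  then have "f = a + a' \<and> g = b + b'"
    using fg(1,2) ab(1,2) ab'(1,2) vecs_mono[OF assms(1), THEN subsetD]
    by (subst (asm) dotted_sum_eq_iff) (auto intro!: add_in_vecs)
  moreover have "(a, b) \<in> dot_rel X V" "(a', b') \<in> dot_rel X V'"
    using ab ab' fg by (auto simp: dot_rel_def)
  ultimately show "(f, g) \<in> dot_rel X V + dot_rel X V'"
    using set_plus_intro[of "(a, b)" _ "(a', b')"] by simp
next
  fix f g assume "(f, g) \<in> dot_rel X V + dot_rel X V'"
  then obtain a b a' b' where ab: "(a, b) \<in> dot_rel X V" "(a', b') \<in> dot_rel X V'"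
    and fg: "f = a + a'" "g = b + b'" by (auto elim!: set_plus_elim)
  have "f + dotted g = (a + dotted b) + (a' + dotted b')"
    unfolding fg by (simp add: dotted_add ac_simps)
  also have "\<dots> \<in> V + V'" using ab by (intro set_plus_intro) (auto simp: dot_rel_def)
  finally have "f + dotted g \<in> V + V'" .
  moreover have "f \<in> vecs X" "g \<in> vecs X"
    unfolding fg using ab by (auto simp: dot_rel_def intro: add_in_vecs)
  ultimately show "(f, g) \<in> dot_rel X (V + V')" by (simp add: dot_rel_def)
qed

lemma vspace_square:
  assumes "X \<subseteq> I" "vspace X U"
  shows "vspace (X \<union> dot ` X) (U \<oplus> dotted ` U)"
proof -
  have U: "U \<subseteq> vecs X" "fun_vs.subspace U" using assms(2) by (auto simp: vspace_def)
  have "fun_vs.subspace (dotted ` U)"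
  proof (rule fun_vs.subspaceI)
    show "0 \<in> dotted ` U"
      using imageI[OF fun_vs.subspace_0[OF U(2)], of dotted] by (simp add: dotted_0)
    show "f + g \<in> dotted ` U" if "f \<in> dotted ` U" "g \<in> dotted ` U" for f g
      using that by (auto simp flip: dotted_add intro!: imageI fun_vs.subspace_add[OF U(2)])
    show "(\<lambda>i. c * f i) \<in> dotted ` U" if "f \<in> dotted ` U" for c f
      using that by (auto simp flip: dotted_scale intro!: imageI fun_vs.subspace_scale[OF U(2)])
  qed
  moreover have "dotted ` U \<subseteq> vecs (dot ` X)" using U(1) dotted_in_vecs[OF assms(1)] by blast
  ultimately show ?thesis by (intro vspace_direct_sum[OF assms(2)]) (simp add: vspace_def)
qed

end

section \<open>Invariant subspaces of linked spaces\<close>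

context dotted_copy
begin

lemma E_linked_imp_linked_relations:
  assumes WP: "W \<union> P = I" "W \<inter> P = {}" and E: "E_linked dot W (dot ` W) P (dot ` P) R S V1 V2"
  shows "linked_relations (dot_rel W R) (dot_rel P S) (pair_rel W P V1) (pair_rel W P (undotted V2))"
  using E[unfolded E_linked_iff_linked[OF WP]] unfolding vspace_def
  by unfold_locales
    (simp_all add: add_subgroup_dot_rel add_subgroup_pair_rel add_subgroup_undotted add_subgroup_subspace)

text \<open>
Let \<open>A\<close> and \<open>B\<close> be the relations of \<open>V1\<close> and \<open>V2\<close>, and write \<open>S\<close> also for its own relation.
The hypothesis on \<open>relabel dot P U\<close> says \<open>U \<subseteq> Range S\<close>, and the one on \<open>V1\<close>
and \<open>V2\<close> says that \<open>A\<close> and \<open>B\<close> have the same fibre over \<open>0\<close>. Hence \<open>T\<close> is the pullback of \<open>U\<close> along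
\<open>A\<close> as well as along \<open>B\<close>, and adding \<open>T \<oplus> relabel dot W T\<close> to a space adds \<open>T \<times> T\<close> to its relation.
\<close>

lemma sum_of_invariant_linked:
  assumes WP: "W \<union> P = I" "W \<inter> P = {}" and E: "E_linked dot W (dot ` W) P (dot ` P) R S V1 V2"
    and inv: "invariant_in dot P (dot ` P) U S"
    and range: "relabel dot P U \<subseteq> vrestrict S (dot ` P)"
    and contr: "relabel dot W (vcontract V1 W) = vcontract V2 (dot ` W)"
    and T: "T = matched I (relabel (inv_into I dot) (dot ` I) V2) P U"
  shows "T = matched I V1 P U" "invariant_in dot W (dot ` W) T R"
    "relabel dot W T \<subseteq> vrestrict R (dot ` W)"
    "E_linked dot W (dot ` W) P (dot ` P)
      (R + (T \<oplus> relabel dot W T)) (S + (U \<oplus> relabel dot P U)) V1 V2"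
proof -
  let ?R = "dot_rel W R" and ?S = "dot_rel P S"
    and ?A = "pair_rel W P V1" and ?B = "pair_rel W P (undotted V2)"
  interpret linked_relations ?R ?S ?A ?B by (rule E_linked_imp_linked_relations[OF WP E])
  have sub: "W \<subseteq> I" "P \<subseteq> I" using WP by auto
  note E' = E[unfolded E_linked_iff_linked[OF WP]]
  note inv' = inv[unfolded invariant_in_iff[OF sub(2)]]
  from E' inv' have vs: "vspace (W \<union> dot ` W) R" "vspace (P \<union> dot ` P) S" "vspace I V1"
      "vspace (dot ` I) V2" "vspace P U"
    by simp_all
  then have v: "R \<subseteq> vecs (W \<union> dot ` W)" "S \<subseteq> vecs (P \<union> dot ` P)" "V1 \<subseteq> vecs I"
      "V2 \<subseteq> vecs (dot ` I)" "U \<subseteq> vecs P"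
    by (simp_all add: vspace_def)
  have Range: "U \<subseteq> Range ?S"
    using range unfolding relabel_subset_vrestrict_iff[OF sub(2) v(5,2)] .
  have W_sub: "vcontract V1 W \<subseteq> vecs W" "{f. (f, 0) \<in> ?B} \<subseteq> vecs W"
    by (auto simp: vcontract_def pair_rel_def)
  have "dotted ` vcontract V1 W = dotted ` {f. (f, 0) \<in> ?B}"
    using contr unfolding relabel_eq_image[OF sub(1) W_sub(1)] vcontract_dot[OF WP(1)] .
  then have "vcontract V1 W = {f. (f, 0) \<in> ?B}"
    by (simp only: dotted_image_eq_iff[OF W_sub[THEN order_trans[OF _ vecs_mono[OF sub(1)]]]])
  then have fibre: "{w. (w, 0) \<in> ?A} = {w. (w, 0) \<in> ?B}" unfolding vcontract_eq[of V1 W P] .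
  have AB: "?A\<inverse> `` U = ?B\<inverse> `` U" by (rule pullbacks_eq_if_Range[OF Range fibre])
  have mA: "matched I V1 P U = ?A\<inverse> `` U"
    using matched_eq_Image[OF WP(2) v(5), of V1] v(3) unfolding WP(1) .
  have TB: "T = ?B\<inverse> `` U"
    unfolding T relabel_inv_eq_undotted[OF v(4)]
    using matched_eq_Image[OF WP(2) v(5), of "undotted V2"] undotted_subset unfolding WP(1) .
  have TA: "T = ?A\<inverse> `` U" using TB AB by simp
  show "T = matched I V1 P U" using TA mA by simp
  have vT: "vspace W T"
    unfolding TA by (rule vspace_pullback[OF _ vs(5)]) (simp add: WP(1) vs(3))
  then have T_sub: "T \<subseteq> vecs W" by (simp add: vspace_def)
  show "invariant_in dot W (dot ` W) T R"
    unfolding invariant_in_iff[OF sub(1)] using vT vs(1) invariant_pullback[OF _ _ AB] inv'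
    unfolding TA by blast
  show "relabel dot W T \<subseteq> vrestrict R (dot ` W)"
    unfolding relabel_subset_vrestrict_iff[OF sub(1) T_sub v(1)]
    using pullback_in_Range[OF Range] unfolding TB .
  have sq: "vspace (W \<union> dot ` W) (T \<oplus> dotted ` T)" "vspace (P \<union> dot ` P) (U \<oplus> dotted ` U)"
    using vspace_square sub vT vs(5) by blast+
  then have sq': "T \<oplus> dotted ` T \<subseteq> vecs (W \<union> dot ` W)" "U \<oplus> dotted ` U \<subseteq> vecs (P \<union> dot ` P)"
    by (simp_all add: vspace_def)
  have "linked (?R + T \<times> T) (?S + U \<times> U) ?A ?B"
    using linked_sum[OF Range] unfolding TB .
  then show "E_linked dot W (dot ` W) P (dot ` P)
      (R + (T \<oplus> relabel dot W T)) (S + (U \<oplus> relabel dot P U)) V1 V2"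
    unfolding E_linked_iff_linked[OF WP] relabel_eq_image[OF sub(1) T_sub]
      relabel_eq_image[OF sub(2) v(5)]
    by (simp add: vspace_plus vs sq dot_rel_plus[OF sub(1) v(1) sq'(1)]
        dot_rel_plus[OF sub(2) v(2) sq'(2)] dot_rel_square sub T_sub v(5))
qed

text \<open>
With the same conventions as before, the hypotheses say that \<open>U\<close> contains the fibre of \<open>S\<close> over \<open>0\<close> and that \<open>A\<close> and \<open>B\<close> have the same
domain, which again makes the two pullbacks of \<open>U\<close> equal.
\<close>

lemma intersection_with_invariant_linked:
  assumes WP: "W \<union> P = I" "W \<inter> P = {}" and E: "E_linked dot W (dot ` W) P (dot ` P) R S V1 V2"
    and inv: "invariant_in dot P (dot ` P) U S"
    and fibre: "vcontract S P \<subseteq> U"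
    and dom: "relabel dot W (vrestrict V1 W) = vrestrict V2 (dot ` W)"
    and T: "T = matched I V1 P U"
  shows "relabel dot W T = matched (dot ` I) V2 (dot ` P) (relabel dot P U)"
    "invariant_in dot W (dot ` W) T R" "vcontract R W \<subseteq> T"
    "E_linked dot W (dot ` W) P (dot ` P)
      (R \<inter> (T \<oplus> relabel dot W T)) (S \<inter> (U \<oplus> relabel dot P U)) V1 V2"
proof -
  let ?R = "dot_rel W R" and ?S = "dot_rel P S"
    and ?A = "pair_rel W P V1" and ?B = "pair_rel W P (undotted V2)"
  interpret linked_relations ?R ?S ?A ?B by (rule E_linked_imp_linked_relations[OF WP E])
  have sub: "W \<subseteq> I" "P \<subseteq> I" using WP by auto
  note E' = E[unfolded E_linked_iff_linked[OF WP]]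
  note inv' = inv[unfolded invariant_in_iff[OF sub(2)]]
  from E' inv' have vs: "vspace (W \<union> dot ` W) R" "vspace (P \<union> dot ` P) S" "vspace I V1"
      "vspace (dot ` I) V2" "vspace P U"
    by simp_all
  then have v: "R \<subseteq> vecs (W \<union> dot ` W)" "S \<subseteq> vecs (P \<union> dot ` P)" "V1 \<subseteq> vecs I"
      "V2 \<subseteq> vecs (dot ` I)" "U \<subseteq> vecs P"
    by (simp_all add: vspace_def)
  have U: "add_subgroup U" using vs(5) by (simp add: vspace_def add_subgroup_subspace)
  have fib: "{p. (p, 0) \<in> ?S} \<subseteq> U" using fibre unfolding vcontract_eq_dot_rel .
  have W_sub: "vrestrict V1 W \<subseteq> vecs W" "Domain ?B \<subseteq> vecs W"
    by (auto simp: vrestrict_def restr_in_vecs pair_rel_def)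
  have "dotted ` vrestrict V1 W = dotted ` Domain ?B"
    using dom unfolding relabel_eq_image[OF sub(1) W_sub(1)] vrestrict_dot[OF WP v(4)] .
  then have "vrestrict V1 W = Domain ?B"
    by (simp only: dotted_image_eq_iff[OF W_sub[THEN order_trans[OF _ vecs_mono[OF sub(1)]]]])
  then have Dom: "Domain ?A = Domain ?B"
    using vrestrict_eq[OF WP(2), of V1] v(3) by (simp add: WP(1))
  have AB: "?A\<inverse> `` U = ?B\<inverse> `` U" by (rule pullbacks_eq_if_Domain[OF U fib Dom])
  have TA: "T = ?A\<inverse> `` U"
    unfolding T using matched_eq_Image[OF WP(2) v(5), of V1] v(3) unfolding WP(1) .
  have vT: "vspace W T"
    unfolding TA by (rule vspace_pullback[OF _ vs(5)]) (simp add: WP(1) vs(3))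
  then have T_sub: "T \<subseteq> vecs W" by (simp add: vspace_def)
  have im: "dot ` W \<union> dot ` P = dot ` I" by (simp add: WP(1) flip: image_Un)
  show "relabel dot W T = matched (dot ` I) V2 (dot ` P) (relabel dot P U)"
    unfolding relabel_eq_image[OF sub(1) T_sub] relabel_eq_image[OF sub(2) v(5)]
      matched_dot[OF WP v(4,5), unfolded im]
    unfolding TA AB ..
  show "invariant_in dot W (dot ` W) T R"
    unfolding invariant_in_iff[OF sub(1)] using vT vs(1) invariant_pullback[OF _ _ AB] inv'
    unfolding TA by blast
  show "vcontract R W \<subseteq> T"
    unfolding vcontract_eq_dot_rel TA by (rule fibre_in_pullback[OF fib])
  have sq: "vspace (W \<union> dot ` W) (T \<oplus> dotted ` T)" "vspace (P \<union> dot ` P) (U \<oplus> dotted ` U)"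
    using vspace_square sub vT vs(5) by blast+
  have "linked (?R \<inter> T \<times> T) (?S \<inter> U \<times> U) ?A ?B"
    using linked_Int[OF U fib] unfolding TA .
  then show "E_linked dot W (dot ` W) P (dot ` P)
      (R \<inter> (T \<oplus> relabel dot W T)) (S \<inter> (U \<oplus> relabel dot P U)) V1 V2"
    unfolding E_linked_iff_linked[OF WP] relabel_eq_image[OF sub(1) T_sub]
      relabel_eq_image[OF sub(2) v(5)]
    by (simp add: vspace_Int vs sq dot_rel_Int dot_rel_square sub T_sub v(5))
qed

end

theorem theorem77:
  fixes W W' P P' :: "'a set" and dot :: "'a \<Rightarrow> 'a"
    and VWW' VPP' V1 V2 :: "('a \<Rightarrow> 'f :: field) set"
  assumes "finite W" "finite P"
    and "bij_betw dot W W'" "bij_betw dot P P'"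
    and "W \<inter> W' = {}" "W \<inter> P = {}" "W \<inter> P' = {}" "W' \<inter> P = {}" "W' \<inter> P' = {}" "P \<inter> P' = {}"
    and "E_linked dot W W' P P' VWW' VPP' V1 V2"
  shows
    "(\<forall>VP VW.
        invariant_in dot P P' VP VPP' \<longrightarrow>
        relabel dot P VP \<subseteq> vrestrict VPP' P' \<longrightarrow>
        relabel dot W (vcontract V1 W) = vcontract V2 W' \<longrightarrow>
        VW = matched (W \<union> P) (relabel (inv_into (W \<union> P) dot) (W' \<union> P') V2) P VP \<longrightarrow>
          VW = matched (W \<union> P) V1 P VP \<and>
          invariant_in dot W W' VW VWW' \<and>
          vrestrict VWW' W' \<supseteq> relabel dot W VW \<and>
          E_linked dot W W' P P'
            (VWW' + (VW \<oplus> relabel dot W VW)) (VPP' + (VP \<oplus> relabel dot P VP)) V1 V2)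
     \<and>
     (\<forall>VP VW.
        invariant_in dot P P' VP VPP' \<longrightarrow>
        VP \<supseteq> vcontract VPP' P \<longrightarrow>
        relabel dot W (vrestrict V1 W) = vrestrict V2 W' \<longrightarrow>
        VW = matched (W \<union> P) V1 P VP \<longrightarrow>
          relabel dot W VW = matched (W' \<union> P') V2 P' (relabel dot P VP) \<and>
          invariant_in dot W W' VW VWW' \<and>
          vcontract VWW' W \<subseteq> VW \<and>
          E_linked dot W W' P P'
            (VWW' \<inter> (VW \<oplus> relabel dot W VW)) (VPP' \<inter> (VP \<oplus> relabel dot P VP)) V1 V2)"
proof -
  have W': "W' = dot ` W" and P': "P' = dot ` P"
    using assms(3,4) by (simp_all add: bij_betw_imp_surj_on)
  have "inj_on dot (W \<union> P)"
    using assms(3,4,9)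
    by (auto simp: inj_on_Un W' P' bij_betw_def)
  moreover have "(W \<union> P) \<inter> dot ` (W \<union> P) = {}"
    using assms(5,7,8,10) unfolding image_Un W'[symmetric] P'[symmetric] by blast
  ultimately interpret dotted_copy dot "W \<union> P" by unfold_locales
  have im: "W' \<union> P' = dot ` (W \<union> P)" by (simp add: W' P' image_Un)
  have E: "E_linked dot W (dot ` W) P (dot ` P) VWW' VPP' V1 V2"
    using assms(11) by (simp add: W' P')
  show ?thesis
    unfolding im unfolding W' P'
    using sum_of_invariant_linked[OF refl \<open>W \<inter> P = {}\<close> E]
      intersection_with_invariant_linked[OF refl \<open>W \<inter> P = {}\<close> E]
    by (intro conjI allI impI) simp_all
qed

end
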